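(* Let $\alpha\ge0$ and let $A_1=\tilde A_0+\alpha$, $B_1=\tilde B_0$, $C_1=\tilde C_0-\alpha(q^n)^2$ be the coefficients (defined in the context) of the equation $$A_1(q^{n+1})^2+B_1q^{n+1}+C_1=0$$ for the unknown $q^{n+1}$ arising in the RLM-Q-CN scheme for the double-well potential. Assume $q^n>0$. If $$\alpha>\max\left\{-\tilde A_0,\ \frac{\tilde C_0}{(q^n)^2}\right\},$$ then $A_1>0$ and $C_1<0$. Consequently, the discriminant satisfies $\Delta_1=B_1^2-4A_1C_1>0$, and the two real roots of the equation have opposite signs; hence the equation admits exactly one positive root. Moreover, as $\alpha\to\infty$ (with $\phi^n,\phi^{n-1},\phi^{n-2},q^n,\Delta t$ fixed) the two roots tend to $q^n$ and $-q^n$ respectively, so that for all sufficiently large $\alpha$ the positive root is the unique root closest to $q^n$; that is, the rule selecting as $q^{n+1}$ the root closest to $q^n$ returns the positive root, and $q^{n+1}$ is uniquely determined.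
   Context: Setting. $\Omega\subset\mathbb R^d$ is a bounded domain; $\mathcal L$ and $\mathcal M$ are linear, self-adjoint, non-negative operators with respect to the $L^2(\Omega)$ inner product (with homogeneous Neumann or periodic boundary conditions); $\Delta t>0$; $F(\phi)=\frac14(\phi^2-1)^2$ and $f(\phi)=F'(\phi)=\phi(\phi^2-1)$. The operator $\mathcal G:=\frac1{\Delta t}I+\frac12\mathcal M\mathcal L$ is assumed invertible. The previous iterates $\phi^n,\phi^{n-1},\phi^{n-2}$ (sufficiently regular functions on $\Omega$) and the scalar $q^n\in\mathbb R$ are given; $\alpha\ge0$ is the relaxation parameter. Extrapolations: $\overline\phi^{\,n+\frac12}=\frac32\phi^n-\frac12\phi^{n-1}$, $\overline\phi^{\,n+1}=2\phi^n-\phi^{n-1}$, $\overline\phi^{\,n}=2\phi^{n-1}-\phi^{n-2}$. Also $q^{n+\frac12}=\frac12(q^n+q^{n+1})$. The functions $\phi_1^{n+1},\phi_2^{n+1}$ are defined by $$\mathcal G\phi_1^{n+1}=\frac1{\Delta t}\phi^n-\frac12\mathcal M\mathcal L\phi^n-\frac12\mathcal M\,q^nf(\overline\phi^{\,n+\frac12}),\qquad \mathcal G\phi_2^{n+1}=-\frac12\mathcal M f(\overline\phi^{\,n+\frac12}),$$ and the new iterate is $\phi^{n+1}=\phi_1^{n+1}+q^{n+1}\phi_2^{n+1}$. With $F^{n+1}=\frac14(\phi^{n+1}\overline\phi^{\,n+1}-1)^2$ and $F^n=\frac14(\phi^n\overline\phi^{\,n}-1)^2$, the scalar $q^{n+1}$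 is determined by $$\int_\Omega(F^{n+1}-F^n)\,d\mathbf x+\alpha\big[(q^{n+1})^2-(q^n)^2\big]=q^{n+\frac12}\int_\Omega f(\overline\phi^{\,n+\frac12})(\phi^{n+1}-\phi^n)\,d\mathbf x,$$ which is the equation $A_1(q^{n+1})^2+B_1q^{n+1}+C_1=0$ with $A_1=\tilde A_0+\alpha$, $B_1=\tilde B_0$, $C_1=\tilde C_0-\alpha(q^n)^2$, where $$A_0=\int_\Omega\tfrac14(\overline\phi^{\,n+1}\phi_2^{n+1})^2d\mathbf x,\quad B_0=\int_\Omega\tfrac12(\overline\phi^{\,n+1}\phi_1^{n+1}-1)\,\overline\phi^{\,n+1}\phi_2^{n+1}d\mathbf x,\quad C_0=\int_\Omega\tfrac14(\overline\phi^{\,n+1}\phi_1^{n+1}-1)^2d\mathbf x,$$ $$\tilde A_0=A_0-\tfrac12\int_\Omega f(\overline\phi^{\,n+\frac12})\phi_2^{n+1}d\mathbf x,$$ $$\tilde B_0=B_0-\tfrac12\int_\Omega f(\overline\phi^{\,n+\frac12})(\phi_1^{n+1}-\phi^n)\,d\mathbf x-\tfrac12q^n\int_\Omega f(\overline\phi^{\,n+\frac12})\phi_2^{n+1}d\mathbf x,$$ $$\tilde C_0=C_0-\int_\Omega\tfrac14(\phi^n\overline\phi^{\,n}-1)^2d\mathbf x-\tfrac12q^n\int_\Omega f(\overline\phi^{\,n+\frac12})(\phi_1^{n+1}-\phi^n)\,d\mathbf x.$$ *)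

theory Defs
  imports "HOL-Analysis.Analysis"
begin

section \<open>Operators on \<open>L\<^sup>2(\<Omega>)\<close>\<close>

text \<open>Elements of \<open>L\<^sup>2(\<Omega>)\<close> are represented by functions, and equality in \<open>L\<^sup>2(\<Omega>)\<close> is equality
  almost everywhere on \<open>\<Omega>\<close>.\<close>

definition L2 :: "(real ^ 'd) set \<Rightarrow> (real ^ 'd \<Rightarrow> real) set" where
  "L2 \<Omega> = {u. u \<in> borel_measurable (lebesgue_on \<Omega>) \<and> integrable (lebesgue_on \<Omega>) (\<lambda>x. (u x)\<^sup>2)}"

definition l2_inner :: "(real ^ 'd) set \<Rightarrow> (real ^ 'd \<Rightarrow> real) \<Rightarrow> (real ^ 'd \<Rightarrow> real) \<Rightarrow> real" where
  "l2_inner \<Omega> u v = (LINT x|lebesgue_on \<Omega>. u x * v x)"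

definition ae_eq :: "(real ^ 'd) set \<Rightarrow> (real ^ 'd \<Rightarrow> real) \<Rightarrow> (real ^ 'd \<Rightarrow> real) \<Rightarrow> bool" where
  "ae_eq \<Omega> u v \<longleftrightarrow> (AE x in lebesgue_on \<Omega>. u x = v x)"

definition ess_bounded :: "(real ^ 'd) set \<Rightarrow> (real ^ 'd \<Rightarrow> real) \<Rightarrow> bool" where
  "ess_bounded \<Omega> u \<longleftrightarrow>
     u \<in> borel_measurable (lebesgue_on \<Omega>) \<and> (\<exists>C. AE x in lebesgue_on \<Omega>. \<bar>u x\<bar> \<le> C)"

text \<open>A (possibly unbounded) operator is a pair of a domain \<open>D\<close> and a map \<open>T\<close>, of which only the
  values on \<open>D\<close> matter. Boundary conditions (homogeneous Neumann, periodic) are part of \<open>D\<close>.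
  The last clause says that \<open>D\<close> and \<open>T\<close> are compatible with almost-everywhere equality.\<close>

definition linear_operator ::
  "(real ^ 'd) set \<Rightarrow> (real ^ 'd \<Rightarrow> real) set \<Rightarrow> ((real ^ 'd \<Rightarrow> real) \<Rightarrow> real ^ 'd \<Rightarrow> real) \<Rightarrow> bool" where
  "linear_operator \<Omega> D T \<longleftrightarrow>
     D \<subseteq> L2 \<Omega> \<and> (\<forall>u\<in>D. T u \<in> L2 \<Omega>) \<and> (\<lambda>x. 0) \<in> D \<and>
     (\<forall>u\<in>D. \<forall>v\<in>D. \<forall>a b. (\<lambda>x. a * u x + b * v x) \<in> D \<and>
        ae_eq \<Omega> (T (\<lambda>x. a * u x + b * v x)) (\<lambda>x. a * T u x + b * T v x)) \<and>
     (\<forall>u\<in>D. \<forall>v\<in>L2 \<Omega>. ae_eq \<Omega> u v \<longrightarrow> v \<in> D \<and> ae_eq \<Omega> (T u) (T v))"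

text \<open>The last clause of the next definition says that \<open>T\<close> equals its adjoint, domains included:
  \<open>(v, w)\<close> is in the graph of the adjoint iff it is in the graph of \<open>T\<close>.\<close>

definition self_adjoint_operator ::
  "(real ^ 'd) set \<Rightarrow> (real ^ 'd \<Rightarrow> real) set \<Rightarrow> ((real ^ 'd \<Rightarrow> real) \<Rightarrow> real ^ 'd \<Rightarrow> real) \<Rightarrow> bool" where
  "self_adjoint_operator \<Omega> D T \<longleftrightarrow>
     (\<forall>v\<in>L2 \<Omega>. \<forall>e>0. \<exists>u\<in>D. l2_inner \<Omega> (\<lambda>x. u x - v x) (\<lambda>x. u x - v x) < e) \<and>
     (\<forall>v\<in>L2 \<Omega>. \<forall>w\<in>L2 \<Omega>.
        (\<forall>u\<in>D. l2_inner \<Omega> (T u) v = l2_inner \<Omega> u w) \<longleftrightarrow> v \<in> D \<and> ae_eq \<Omega> (T v) w)"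

definition nonneg_operator ::
  "(real ^ 'd) set \<Rightarrow> (real ^ 'd \<Rightarrow> real) set \<Rightarrow> ((real ^ 'd \<Rightarrow> real) \<Rightarrow> real ^ 'd \<Rightarrow> real) \<Rightarrow> bool" where
  "nonneg_operator \<Omega> D T \<longleftrightarrow> (\<forall>u\<in>D. 0 \<le> l2_inner \<Omega> (T u) u)"

definition invertible_operator ::
  "(real ^ 'd) set \<Rightarrow> (real ^ 'd \<Rightarrow> real) set \<Rightarrow> ((real ^ 'd \<Rightarrow> real) \<Rightarrow> real ^ 'd \<Rightarrow> real) \<Rightarrow> bool" where
  "invertible_operator \<Omega> D T \<longleftrightarrow>
     (\<forall>g\<in>L2 \<Omega>. \<exists>u\<in>D. ae_eq \<Omega> (T u) g \<and> (\<forall>v\<in>D. ae_eq \<Omega> (T v) g \<longrightarrow> ae_eq \<Omega> v u))"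

text \<open>The operator \<open>I/dt + M L/2\<close> with its natural domain.\<close>

definition G_dom ::
  "(real ^ 'd \<Rightarrow> real) set \<Rightarrow> ((real ^ 'd \<Rightarrow> real) \<Rightarrow> real ^ 'd \<Rightarrow> real) \<Rightarrow>
   (real ^ 'd \<Rightarrow> real) set \<Rightarrow> (real ^ 'd \<Rightarrow> real) set" where
  "G_dom DL L DM = {u \<in> DL. L u \<in> DM}"

definition G_op ::
  "real \<Rightarrow> ((real ^ 'd \<Rightarrow> real) \<Rightarrow> real ^ 'd \<Rightarrow> real) \<Rightarrow> ((real ^ 'd \<Rightarrow> real) \<Rightarrow> real ^ 'd \<Rightarrow> real) \<Rightarrow>
   (real ^ 'd \<Rightarrow> real) \<Rightarrow> real ^ 'd \<Rightarrow> real" where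
  "G_op dt L M u = (\<lambda>x. 1 / dt * u x + 1 / 2 * M (L u) x)"


section \<open>Potential, extrapolations and coefficients\<close>

text \<open>Throughout, \<open>p\<close>, \<open>pm1\<close>, \<open>pm2\<close> stand for \<open>\<phi>\<close> at levels \<open>n\<close>, \<open>n-1\<close>, \<open>n-2\<close>, \<open>qn\<close> for \<open>q\<close> at
  level \<open>n\<close>, and \<open>p1\<close>, \<open>p2\<close> for \<open>\<phi>\<^sub>1\<close>, \<open>\<phi>\<^sub>2\<close> at level \<open>n+1\<close>.\<close>

definition F_dw :: "real \<Rightarrow> real" where
  "F_dw s = 1 / 4 * (s\<^sup>2 - 1)\<^sup>2"

definition f_dw :: "real \<Rightarrow> real" where
  "f_dw s = s * (s\<^sup>2 - 1)"

lemma F_dw_deriv: "(F_dw has_real_derivative f_dw s) (at s)"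
  unfolding F_dw_def f_dw_def
  by (auto intro!: derivative_eq_intros simp: power2_eq_square algebra_simps)

definition extrap_half :: "(real ^ 'd \<Rightarrow> real) \<Rightarrow> (real ^ 'd \<Rightarrow> real) \<Rightarrow> real ^ 'd \<Rightarrow> real" where
  "extrap_half u um1 = (\<lambda>x. 3 / 2 * u x - 1 / 2 * um1 x)"

text \<open>Extrapolation to the next full level, so that \<open>\<phi>\<close>-bar at level \<open>n+1\<close> is \<open>extrap p pm1\<close> and
  \<open>\<phi>\<close>-bar at level \<open>n\<close> is \<open>extrap pm1 pm2\<close>.\<close>

definition extrap :: "(real ^ 'd \<Rightarrow> real) \<Rightarrow> (real ^ 'd \<Rightarrow> real) \<Rightarrow> real ^ 'd \<Rightarrow> real" where
  "extrap u um1 = (\<lambda>x. 2 * u x - um1 x)"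

definition f_half :: "(real ^ 'd \<Rightarrow> real) \<Rightarrow> (real ^ 'd \<Rightarrow> real) \<Rightarrow> real ^ 'd \<Rightarrow> real" where
  "f_half p pm1 = (\<lambda>x. f_dw (extrap_half p pm1 x))"

definition A0 ::
  "(real ^ 'd) set \<Rightarrow> (real ^ 'd \<Rightarrow> real) \<Rightarrow> (real ^ 'd \<Rightarrow> real) \<Rightarrow> (real ^ 'd \<Rightarrow> real) \<Rightarrow> real" where
  "A0 \<Omega> p pm1 p2 = (LINT x|lebesgue_on \<Omega>. 1 / 4 * (extrap p pm1 x * p2 x)\<^sup>2)"

definition B0 ::
  "(real ^ 'd) set \<Rightarrow> (real ^ 'd \<Rightarrow> real) \<Rightarrow> (real ^ 'd \<Rightarrow> real) \<Rightarrow> (real ^ 'd \<Rightarrow> real) \<Rightarrow>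
   (real ^ 'd \<Rightarrow> real) \<Rightarrow> real" where
  "B0 \<Omega> p pm1 p1 p2 =
     (LINT x|lebesgue_on \<Omega>. 1 / 2 * (extrap p pm1 x * p1 x - 1) * extrap p pm1 x * p2 x)"

definition C0 ::
  "(real ^ 'd) set \<Rightarrow> (real ^ 'd \<Rightarrow> real) \<Rightarrow> (real ^ 'd \<Rightarrow> real) \<Rightarrow> (real ^ 'd \<Rightarrow> real) \<Rightarrow> real" where
  "C0 \<Omega> p pm1 p1 = (LINT x|lebesgue_on \<Omega>. 1 / 4 * (extrap p pm1 x * p1 x - 1)\<^sup>2)"

definition A0_tilde ::
  "(real ^ 'd) set \<Rightarrow> (real ^ 'd \<Rightarrow> real) \<Rightarrow> (real ^ 'd \<Rightarrow> real) \<Rightarrow> (real ^ 'd \<Rightarrow> real) \<Rightarrow> real" where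
  "A0_tilde \<Omega> p pm1 p2 =
     A0 \<Omega> p pm1 p2 - 1 / 2 * (LINT x|lebesgue_on \<Omega>. f_half p pm1 x * p2 x)"

definition B0_tilde ::
  "(real ^ 'd) set \<Rightarrow> (real ^ 'd \<Rightarrow> real) \<Rightarrow> (real ^ 'd \<Rightarrow> real) \<Rightarrow> (real ^ 'd \<Rightarrow> real) \<Rightarrow>
   (real ^ 'd \<Rightarrow> real) \<Rightarrow> real \<Rightarrow> real" where
  "B0_tilde \<Omega> p pm1 p1 p2 qn =
     B0 \<Omega> p pm1 p1 p2
     - 1 / 2 * (LINT x|lebesgue_on \<Omega>. f_half p pm1 x * (p1 x - p x))
     - 1 / 2 * qn * (LINT x|lebesgue_on \<Omega>. f_half p pm1 x * p2 x)"

definition C0_tilde ::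
  "(real ^ 'd) set \<Rightarrow> (real ^ 'd \<Rightarrow> real) \<Rightarrow> (real ^ 'd \<Rightarrow> real) \<Rightarrow> (real ^ 'd \<Rightarrow> real) \<Rightarrow>
   (real ^ 'd \<Rightarrow> real) \<Rightarrow> real \<Rightarrow> real" where
  "C0_tilde \<Omega> p pm1 pm2 p1 qn =
     C0 \<Omega> p pm1 p1
     - (LINT x|lebesgue_on \<Omega>. 1 / 4 * (p x * extrap pm1 pm2 x - 1)\<^sup>2)
     - 1 / 2 * qn * (LINT x|lebesgue_on \<Omega>. f_half p pm1 x * (p1 x - p x))"

definition A1 ::
  "(real ^ 'd) set \<Rightarrow> (real ^ 'd \<Rightarrow> real) \<Rightarrow> (real ^ 'd \<Rightarrow> real) \<Rightarrow> (real ^ 'd \<Rightarrow> real) \<Rightarrow>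
   real \<Rightarrow> real" where
  "A1 \<Omega> p pm1 p2 \<alpha> = A0_tilde \<Omega> p pm1 p2 + \<alpha>"

definition B1 ::
  "(real ^ 'd) set \<Rightarrow> (real ^ 'd \<Rightarrow> real) \<Rightarrow> (real ^ 'd \<Rightarrow> real) \<Rightarrow> (real ^ 'd \<Rightarrow> real) \<Rightarrow>
   (real ^ 'd \<Rightarrow> real) \<Rightarrow> real \<Rightarrow> real" where
  "B1 \<Omega> p pm1 p1 p2 qn = B0_tilde \<Omega> p pm1 p1 p2 qn"

definition C1 ::
  "(real ^ 'd) set \<Rightarrow> (real ^ 'd \<Rightarrow> real) \<Rightarrow> (real ^ 'd \<Rightarrow> real) \<Rightarrow> (real ^ 'd \<Rightarrow> real) \<Rightarrow>
   (real ^ 'd \<Rightarrow> real) \<Rightarrow> real \<Rightarrow> real \<Rightarrow> real" where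
  "C1 \<Omega> p pm1 pm2 p1 qn \<alpha> = C0_tilde \<Omega> p pm1 pm2 p1 qn - \<alpha> * qn\<^sup>2"


section \<open>The scalar equation of the scheme\<close>

definition phi_new :: "(real ^ 'd \<Rightarrow> real) \<Rightarrow> (real ^ 'd \<Rightarrow> real) \<Rightarrow> real \<Rightarrow> real ^ 'd \<Rightarrow> real" where
  "phi_new p1 p2 q = (\<lambda>x. p1 x + q * p2 x)"

definition scalar_equation ::
  "(real ^ 'd) set \<Rightarrow> (real ^ 'd \<Rightarrow> real) \<Rightarrow> (real ^ 'd \<Rightarrow> real) \<Rightarrow> (real ^ 'd \<Rightarrow> real) \<Rightarrow>
   (real ^ 'd \<Rightarrow> real) \<Rightarrow> (real ^ 'd \<Rightarrow> real) \<Rightarrow> real \<Rightarrow> real \<Rightarrow> real \<Rightarrow> bool" where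
  "scalar_equation \<Omega> p pm1 pm2 p1 p2 qn \<alpha> q \<longleftrightarrow>
     (LINT x|lebesgue_on \<Omega>. 1 / 4 * (phi_new p1 p2 q x * extrap p pm1 x - 1)\<^sup>2
                           - 1 / 4 * (p x * extrap pm1 pm2 x - 1)\<^sup>2)
     + \<alpha> * (q\<^sup>2 - qn\<^sup>2)
     = 1 / 2 * (qn + q) * (LINT x|lebesgue_on \<Omega>. f_half p pm1 x * (phi_new p1 p2 q x - p x))"

lemma L2_mult_integrable:
  assumes "u \<in> L2 \<Omega>" "v \<in> L2 \<Omega>"
  shows "integrable (lebesgue_on \<Omega>) (\<lambda>x. u x * v x)"
proof (rule Bochner_Integration.integrable_bound)
  show "integrable (lebesgue_on \<Omega>) (\<lambda>x. (u x)\<^sup>2 + (v x)\<^sup>2)"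
    using assms by (auto simp: L2_def)
  show "(\<lambda>x. u x * v x) \<in> borel_measurable (lebesgue_on \<Omega>)"
    using assms by (auto simp: L2_def)
  have "\<bar>a * b\<bar> \<le> a\<^sup>2 + b\<^sup>2" for a b :: real
  proof -
    have "2 * \<bar>a\<bar> * \<bar>b\<bar> \<le> \<bar>a\<bar>\<^sup>2 + \<bar>b\<bar>\<^sup>2" by (rule sum_squares_bound)
    moreover have "0 \<le> \<bar>a\<bar> * \<bar>b\<bar>" by simp
    ultimately show ?thesis unfolding abs_mult power2_abs by linarith
  qed
  then show "AE x in lebesgue_on \<Omega>. norm (u x * v x) \<le> norm ((u x)\<^sup>2 + (v x)\<^sup>2)"
    by simp
qed

lemma L2_ess_bounded_mult:
  assumes "ess_bounded \<Omega> b" "u \<in> L2 \<Omega>"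
  shows "(\<lambda>x. b x * u x) \<in> L2 \<Omega>"
proof -
  obtain C where C: "AE x in lebesgue_on \<Omega>. \<bar>b x\<bar> \<le> C"
    and b: "b \<in> borel_measurable (lebesgue_on \<Omega>)"
    using assms(1) by (auto simp: ess_bounded_def)
  have u: "u \<in> borel_measurable (lebesgue_on \<Omega>)" "integrable (lebesgue_on \<Omega>) (\<lambda>x. (u x)\<^sup>2)"
    using assms(2) by (auto simp: L2_def)
  have "integrable (lebesgue_on \<Omega>) (\<lambda>x. (b x * u x)\<^sup>2)"
  proof (rule Bochner_Integration.integrable_bound)
    show "integrable (lebesgue_on \<Omega>) (\<lambda>x. C\<^sup>2 * (u x)\<^sup>2)" using u by simp
    show "(\<lambda>x. (b x * u x)\<^sup>2) \<in> borel_measurable (lebesgue_on \<Omega>)" using b u by simp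
    show "AE x in lebesgue_on \<Omega>. norm ((b x * u x)\<^sup>2) \<le> norm (C\<^sup>2 * (u x)\<^sup>2)"
      using C
    proof eventually_elim
      case (elim x)
      then have "(b x)\<^sup>2 \<le> C\<^sup>2" using abs_le_square_iff by fastforce
      then show ?case by (simp add: power_mult_distrib mult_right_mono)
    qed
  qed
  then show ?thesis using b u by (simp add: L2_def)
qed

lemma ess_bounded_lincomb:
  assumes "ess_bounded \<Omega> u" "ess_bounded \<Omega> v"
  shows "ess_bounded \<Omega> (\<lambda>x. a * u x - b * v x)"
proof -
  obtain C D where C: "AE x in lebesgue_on \<Omega>. \<bar>u x\<bar> \<le> C" and D: "AE x in lebesgue_on \<Omega>. \<bar>v x\<bar> \<le> D"
    using assms by (auto simp: ess_bounded_def)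
  have "AE x in lebesgue_on \<Omega>. \<bar>a * u x - b * v x\<bar> \<le> \<bar>a\<bar> * C + \<bar>b\<bar> * D"
    using C D
  proof eventually_elim
    case (elim x)
    have "\<bar>a * u x - b * v x\<bar> \<le> \<bar>a\<bar> * \<bar>u x\<bar> + \<bar>b\<bar> * \<bar>v x\<bar>"
      by (metis abs_mult abs_triangle_ineq4)
    also have "\<dots> \<le> \<bar>a\<bar> * C + \<bar>b\<bar> * D"
      using elim by (intro add_mono mult_left_mono) auto
    finally show ?case .
  qed
  then show ?thesis using assms by (auto simp: ess_bounded_def)
qed

lemma const_L2:
  assumes "open \<Omega>" "bounded \<Omega>"
  shows "(\<lambda>x. c) \<in> L2 \<Omega>"
proof -
  have "\<Omega> \<in> lmeasurable" using assms by (simp add: bounded_set_imp_lmeasurable)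
  then show ?thesis by (simp add: L2_def integrable_on_const integrable_const_ivl
      finite_measure.integrable_const finite_measure_lebesgue_on)
qed

lemma L2_diff:
  assumes "u \<in> L2 \<Omega>" "v \<in> L2 \<Omega>"
  shows "(\<lambda>x. u x - v x) \<in> L2 \<Omega>"
proof -
  have "integrable (lebesgue_on \<Omega>) (\<lambda>x. (u x)\<^sup>2 - 2 * (u x * v x) + (v x)\<^sup>2)"
    using assms L2_mult_integrable[OF assms]
    by (intro Bochner_Integration.integrable_add Bochner_Integration.integrable_diff
          integrable_mult_right) (auto simp: L2_def)
  moreover have "(\<lambda>x. (u x - v x)\<^sup>2) = (\<lambda>x. (u x)\<^sup>2 - 2 * (u x * v x) + (v x)\<^sup>2)"
    by (simp add: power2_diff fun_eq_iff)
  ultimately show ?thesis using assms by (auto simp: L2_def)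
qed

lemma scalar_equation_iff_quadratic:
  assumes "open \<Omega>" "bounded \<Omega>"
    and "ess_bounded \<Omega> p" "ess_bounded \<Omega> pm1" "ess_bounded \<Omega> pm2"
    and "p \<in> L2 \<Omega>" "p1 \<in> L2 \<Omega>" "p2 \<in> L2 \<Omega>" "f_half p pm1 \<in> L2 \<Omega>"
  shows "scalar_equation \<Omega> p pm1 pm2 p1 p2 qn \<alpha> q \<longleftrightarrow>
    A1 \<Omega> p pm1 p2 \<alpha> * q\<^sup>2 + B1 \<Omega> p pm1 p1 p2 qn * q + C1 \<Omega> p pm1 pm2 p1 qn \<alpha> = 0"
proof -
  let ?M = "lebesgue_on \<Omega>"
  let ?b = "extrap p pm1" and ?f = "f_half p pm1"
  have b: "ess_bounded \<Omega> ?b" "ess_bounded \<Omega> (extrap pm1 pm2)"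
    using ess_bounded_lincomb[of \<Omega> _ _ 2 1] assms by (auto simp: extrap_def)
  have 1: "(\<lambda>x. ?b x * p1 x - 1) \<in> L2 \<Omega>" "(\<lambda>x. extrap pm1 pm2 x * p x - 1) \<in> L2 \<Omega>"
    and 2: "(\<lambda>x. ?b x * p2 x) \<in> L2 \<Omega>" and 3: "(\<lambda>x. p1 x - p x) \<in> L2 \<Omega>"
    by (intro L2_diff L2_ess_bounded_mult const_L2 assms b)+
  have iA: "integrable ?M (\<lambda>x. 1 / 4 * (?b x * p2 x)\<^sup>2)"
    and iC: "integrable ?M (\<lambda>x. 1 / 4 * (?b x * p1 x - 1)\<^sup>2)"
    and iF: "integrable ?M (\<lambda>x. 1 / 4 * (p x * extrap pm1 pm2 x - 1)\<^sup>2)"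
    using 1 2 by (auto simp: L2_def mult.commute)
  have iB: "integrable ?M (\<lambda>x. 1 / 2 * (?b x * p1 x - 1) * ?b x * p2 x)"
    using integrable_mult_right[OF L2_mult_integrable[OF 1(1) 2], of "1 / 2"]
    by (simp add: mult.assoc)
  have i1: "integrable ?M (\<lambda>x. ?f x * (p1 x - p x))" and i2: "integrable ?M (\<lambda>x. ?f x * p2 x)"
    using L2_mult_integrable assms 3 by blast+
  have "(LINT x|?M. 1 / 4 * (phi_new p1 p2 q x * ?b x - 1)\<^sup>2 - 1 / 4 * (p x * extrap pm1 pm2 x - 1)\<^sup>2)
      = (LINT x|?M. q\<^sup>2 * (1 / 4 * (?b x * p2 x)\<^sup>2) + q * (1 / 2 * (?b x * p1 x - 1) * ?b x * p2 x)
          + 1 / 4 * (?b x * p1 x - 1)\<^sup>2 - 1 / 4 * (p x * extrap pm1 pm2 x - 1)\<^sup>2)"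
    by (rule Bochner_Integration.integral_cong)
       (auto simp: phi_new_def power2_eq_square field_simps)
  also have "\<dots> = q\<^sup>2 * A0 \<Omega> p pm1 p2 + q * B0 \<Omega> p pm1 p1 p2 + C0 \<Omega> p pm1 p1
      - (LINT x|?M. 1 / 4 * (p x * extrap pm1 pm2 x - 1)\<^sup>2)"
    unfolding A0_def B0_def C0_def
    by (subst Bochner_Integration.integral_diff Bochner_Integration.integral_add
          integral_mult_right_zero
        | intro Bochner_Integration.integrable_add integrable_mult_right iA iB iC iF | rule refl)+
  finally have l: "(LINT x|?M. 1 / 4 * (phi_new p1 p2 q x * ?b x - 1)\<^sup>2
        - 1 / 4 * (p x * extrap pm1 pm2 x - 1)\<^sup>2) = \<dots>" .
  have "(LINT x|?M. ?f x * (phi_new p1 p2 q x - p x))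
      = (LINT x|?M. ?f x * (p1 x - p x) + q * (?f x * p2 x))"
    by (rule Bochner_Integration.integral_cong) (auto simp: phi_new_def algebra_simps)
  also have "\<dots> = (LINT x|?M. ?f x * (p1 x - p x)) + q * (LINT x|?M. ?f x * p2 x)"
    using i1 i2 by (subst Bochner_Integration.integral_add) auto
  finally have r: "(LINT x|?M. ?f x * (phi_new p1 p2 q x - p x)) = \<dots>" .
  show ?thesis
    unfolding scalar_equation_def l r A1_def B1_def C1_def A0_tilde_def B0_tilde_def C0_tilde_def
    by (simp add: power2_eq_square algebra_simps) (auto simp: field_simps)
qed

end

theory Submission
  imports Defs "HOL-Library.Quadratic_Discriminant"
begin

text \<open>For large \<open>\<alpha>\<close> the leading coefficient \<open>a + \<alpha>\<close> is positive and the constant term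
  \<open>c - \<alpha> * q\<^sup>2\<close> is negative, so the product of the roots is negative. Dividing the equation by
  \<open>\<alpha>\<close> turns it into a perturbation of \<open>r\<^sup>2 = q\<^sup>2\<close>, which gives the limits of the
  roots; in the limit their distances to \<open>q\<close> are \<open>0\<close> and \<open>2 * q\<close>.\<close>

text \<open>Since \<open>- 4 * a * c\<close> is positive, the discriminant exceeds the square of
  \<open>b\<close>. Its root therefore dominates \<open>b\<close> in absolute value and decides the
  sign of each numerator.\<close>

lemma quadratic_roots_opposite_signs:
  fixes a b c :: real
  assumes "0 < a" "c < 0"
  shows "0 < discrim a b c"
    and "0 < (- b + sqrt (discrim a b c)) / (2 * a)"
    and "(- b - sqrt (discrim a b c)) / (2 * a) < 0"
proof -
  have "a * c < 0" using assms by (simp add: mult_pos_neg)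
  then have less: "b\<^sup>2 < discrim a b c" by (simp add: discrim_def)
  then show "0 < discrim a b c" by (smt (verit) zero_le_power2)
  have "\<bar>b\<bar> < sqrt (discrim a b c)"
    using real_sqrt_less_mono[OF less] by simp
  then show "0 < (- b + sqrt (discrim a b c)) / (2 * a)"
    and "(- b - sqrt (discrim a b c)) / (2 * a) < 0"
    using assms(1) by (auto simp: divide_simps)
qed

lemma quadratic_solution_set:
  fixes a b c :: real
  assumes "a \<noteq> 0" "0 \<le> discrim a b c"
  shows "{x. a * x\<^sup>2 + b * x + c = 0} =
    {(- b - sqrt (discrim a b c)) / (2 * a), (- b + sqrt (discrim a b c)) / (2 * a)}"
  using discriminant_iff[OF assms(1)] assms(2) by auto

text \<open>The factor \<open>s\<close> is meant to be 1 or -1, so that one computation serves both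
  roots. Numerator and denominator are divided by \<alpha>, after which every coefficient
  converges.\<close>

lemma relaxed_quadratic_root_tendsto:
  fixes a b c q s :: real
  assumes "0 \<le> q"
  shows "((\<lambda>\<alpha>. (- b + s * sqrt (discrim (a + \<alpha>) b (c - \<alpha> * q\<^sup>2))) / (2 * (a + \<alpha>)))
    \<longlongrightarrow> s * q) at_top"
proof -
  have inv: "((\<lambda>\<alpha>::real. k / \<alpha>) \<longlongrightarrow> 0) at_top" for k
    by (rule tendsto_divide_0[OF tendsto_const filterlim_at_top_imp_at_infinity[OF filterlim_ident]])
  \<comment> \<open>The limit keeps the shape of the expression, with 0 in place of each quotient by
    \<alpha>, so that the limit rules match it term by term.\<close>
  have lim: "((\<lambda>\<alpha>. (- (b / \<alpha>) + s * sqrt ((b / \<alpha>)\<^sup>2 - 4 * (a / \<alpha> + 1) * (c / \<alpha> - q\<^sup>2)))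
      / (2 * (a / \<alpha> + 1))) \<longlongrightarrow>
      (- 0 + s * sqrt (0\<^sup>2 - 4 * (0 + 1) * (0 - q\<^sup>2))) / (2 * (0 + 1))) at_top"
    by (intro tendsto_intros inv) auto
  \<comment> \<open>The radicand is four times the square of \<open>q\<close>; its root is
    \<open>2 * q\<close> because \<open>q\<close> is nonnegative.\<close>
  have value_at_limit: "(- 0 + s * sqrt (0\<^sup>2 - 4 * (0 + 1) * (0 - q\<^sup>2))) / (2 * (0 + 1)) = s * q"
    using assms by (simp add: real_sqrt_mult)
  have "\<forall>\<^sub>F \<alpha> in at_top.
      (- (b / \<alpha>) + s * sqrt ((b / \<alpha>)\<^sup>2 - 4 * (a / \<alpha> + 1) * (c / \<alpha> - q\<^sup>2))) / (2 * (a / \<alpha> + 1))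
      = (- b + s * sqrt (discrim (a + \<alpha>) b (c - \<alpha> * q\<^sup>2))) / (2 * (a + \<alpha>))"
    using eventually_gt_at_top[of 0]
  proof eventually_elim
    case (elim \<alpha>)
    define t where "t = sqrt ((b / \<alpha>)\<^sup>2 - 4 * (a / \<alpha> + 1) * (c / \<alpha> - q\<^sup>2))"
    \<comment> \<open>The discriminant is homogeneous of degree two in the coefficients. As \<alpha>
      is positive, one factor \<alpha> leaves the square root and cancels against the
      denominator.\<close>
    have "discrim (a + \<alpha>) b (c - \<alpha> * q\<^sup>2)
        = \<alpha>\<^sup>2 * ((b / \<alpha>)\<^sup>2 - 4 * (a / \<alpha> + 1) * (c / \<alpha> - q\<^sup>2))"
      using elim by (simp add: discrim_def field_simps power2_eq_square)
    then have "sqrt (discrim (a + \<alpha>) b (c - \<alpha> * q\<^sup>2)) = \<alpha> * t"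
      using elim by (simp only: real_sqrt_mult real_sqrt_abs abs_of_pos t_def)
    moreover have "- b + s * (\<alpha> * t) = \<alpha> * (- (b / \<alpha>) + s * t)"
      using elim by (simp add: right_diff_distrib)
    moreover have "2 * (a + \<alpha>) = \<alpha> * (2 * (a / \<alpha> + 1))"
      using elim by (simp add: field_simps)
    ultimately have "(- b + s * sqrt (discrim (a + \<alpha>) b (c - \<alpha> * q\<^sup>2))) / (2 * (a + \<alpha>))
        = (\<alpha> * (- (b / \<alpha>) + s * t)) / (\<alpha> * (2 * (a / \<alpha> + 1)))"
      by (simp only:)
    also have "\<dots> = (- (b / \<alpha>) + s * t) / (2 * (a / \<alpha> + 1))"
      using elim by (intro mult_divide_mult_cancel_left) simp
    finally show ?case unfolding t_def by (rule sym)
  qed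
  with lim[unfolded value_at_limit] show ?thesis by (rule Lim_transform_eventually)
qed

text \<open>The difference of the two distances tends to the distance between \<open>m\<close> and
  \<open>l\<close>, which is positive, so it is eventually positive itself.\<close>

lemma eventually_closer_to_limit:
  fixes u v :: "'a \<Rightarrow> real"
  assumes "(u \<longlongrightarrow> l) F" "(v \<longlongrightarrow> m) F" "m \<noteq> l"
  shows "\<forall>\<^sub>F x in F. \<bar>u x - l\<bar> < \<bar>v x - l\<bar>"
proof -
  have "((\<lambda>x. \<bar>v x - l\<bar> - \<bar>u x - l\<bar>) \<longlongrightarrow> \<bar>m - l\<bar> - \<bar>l - l\<bar>) F"
    by (intro tendsto_intros assms)
  then have "\<forall>\<^sub>F x in F. 0 < \<bar>v x - l\<bar> - \<bar>u x - l\<bar>"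
    using assms(3) by (intro order_tendstoD) auto
  then show ?thesis by eventually_elim simp
qed

text \<open>This turns the rule "take the closest root" into an equation for the selected root; the
  strict inequality excludes ties.\<close>

lemma is_arg_min_pair_iff:
  fixes d :: "'a \<Rightarrow> 'b :: linorder"
  assumes "{r. P r} = {y, x}" "d x < d y"
  shows "is_arg_min d P q \<longleftrightarrow> q = x"
proof -
  have "P r \<longleftrightarrow> r = y \<or> r = x" for r using assms(1) by auto
  then show ?thesis using assms(2) by (auto simp: is_arg_min_def)
qed

text \<open>This is the whole claim with the integrals replaced by arbitrary reals \<open>a\<close>,
  \<open>b\<close>, \<open>c\<close>: only the way in which \<alpha> enters the coefficients
  matters.\<close>

lemma relaxed_quadratic_roots:
  fixes a b c q :: real
  assumes "0 < q"
  shows "\<exists>rpos rneg :: real \<Rightarrow> real.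
    (\<forall>\<alpha>\<ge>0. \<alpha> > max (- a) (c / q\<^sup>2) \<longrightarrow>
       a + \<alpha> > 0 \<and> c - \<alpha> * q\<^sup>2 < 0 \<and> b\<^sup>2 - 4 * (a + \<alpha>) * (c - \<alpha> * q\<^sup>2) > 0 \<and>
       rneg \<alpha> < 0 \<and> 0 < rpos \<alpha> \<and>
       {r. (a + \<alpha>) * r\<^sup>2 + b * r + (c - \<alpha> * q\<^sup>2) = 0} = {rneg \<alpha>, rpos \<alpha>} \<and>
       (\<exists>!r. r > 0 \<and> (a + \<alpha>) * r\<^sup>2 + b * r + (c - \<alpha> * q\<^sup>2) = 0)) \<and>
    (rpos \<longlongrightarrow> q) at_top \<and> (rneg \<longlongrightarrow> - q) at_top \<and>
    (\<forall>\<^sub>F \<alpha> in at_top. \<forall>r.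
       is_arg_min (\<lambda>r. \<bar>r - q\<bar>) (\<lambda>r. (a + \<alpha>) * r\<^sup>2 + b * r + (c - \<alpha> * q\<^sup>2) = 0) r
       \<longleftrightarrow> r = rpos \<alpha>)"
proof -
  \<comment> \<open>The quadratic formula defines both functions for every \<alpha>; they are shown
    to be the roots only above the threshold.\<close>
  define rpos where "rpos = (\<lambda>\<alpha>. (- b + sqrt (discrim (a + \<alpha>) b (c - \<alpha> * q\<^sup>2))) / (2 * (a + \<alpha>)))"
  define rneg where "rneg = (\<lambda>\<alpha>. (- b - sqrt (discrim (a + \<alpha>) b (c - \<alpha> * q\<^sup>2))) / (2 * (a + \<alpha>)))"
  let ?root = "\<lambda>\<alpha> r. (a + \<alpha>) * r\<^sup>2 + b * r + (c - \<alpha> * q\<^sup>2) = 0"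
  have signs: "a + \<alpha> > 0" "c - \<alpha> * q\<^sup>2 < 0" if "\<alpha> > max (- a) (c / q\<^sup>2)" for \<alpha>
    using that assms by (auto simp: divide_simps split: if_splits)
  \<comment> \<open>Each of the two sign facts brings its own copy of the threshold condition, hence
    the doubled \<open>that\<close> in later uses.\<close>
  note opp = quadratic_roots_opposite_signs[OF signs]
  have roots: "{r. ?root \<alpha> r} = {rneg \<alpha>, rpos \<alpha>}" if "\<alpha> > max (- a) (c / q\<^sup>2)" for \<alpha>
    unfolding rpos_def rneg_def
    using signs(1)[OF that] opp(1)[OF that that] by (intro quadratic_solution_set) (auto intro: less_imp_le)
  have pos: "0 < rpos \<alpha>" and neg: "rneg \<alpha> < 0" if "\<alpha> > max (- a) (c / q\<^sup>2)" for \<alpha>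
    unfolding rpos_def rneg_def using opp(2,3)[OF that that] by auto
  have unique: "\<exists>!r. r > 0 \<and> ?root \<alpha> r" if "\<alpha> > max (- a) (c / q\<^sup>2)" for \<alpha>
  proof (rule ex1I[of _ "rpos \<alpha>"])
    show "rpos \<alpha> > 0 \<and> ?root \<alpha> (rpos \<alpha>)" using pos[OF that] roots[OF that] by blast
    show "r = rpos \<alpha>" if r: "r > 0 \<and> ?root \<alpha> r" for r
    proof -
      have "r \<in> {rneg \<alpha>, rpos \<alpha>}" using r roots[OF \<open>\<alpha> > _\<close>] by blast
      then show ?thesis using r neg[OF \<open>\<alpha> > _\<close>] by auto
    qed
  qed
  have lim_pos: "(rpos \<longlongrightarrow> q) at_top" and lim_neg: "(rneg \<longlongrightarrow> - q) at_top"
    using relaxed_quadratic_root_tendsto[of q b 1 a c] relaxed_quadratic_root_tendsto[of q b "- 1" a c]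
      assms by (simp_all add: rpos_def rneg_def)
  \<comment> \<open>Positivity of \<open>q\<close> makes the limits \<open>q\<close> and
    \<open>- q\<close> distinct.\<close>
  have "\<forall>\<^sub>F \<alpha> in at_top. \<bar>rpos \<alpha> - q\<bar> < \<bar>rneg \<alpha> - q\<bar>"
    using assms by (intro eventually_closer_to_limit[OF lim_pos lim_neg]) simp
  then have closest: "\<forall>\<^sub>F \<alpha> in at_top. \<forall>r. is_arg_min (\<lambda>r. \<bar>r - q\<bar>) (?root \<alpha>) r \<longleftrightarrow> r = rpos \<alpha>"
    using eventually_gt_at_top[of "max (- a) (c / q\<^sup>2)"]
  proof eventually_elim
    case (elim \<alpha>)
    show ?case by (intro allI is_arg_min_pair_iff[OF roots[OF elim(2)] elim(1)])
  qed
  have discr: "0 < b\<^sup>2 - 4 * (a + \<alpha>) * (c - \<alpha> * q\<^sup>2)" if "\<alpha> > max (- a) (c / q\<^sup>2)" for \<alpha>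
    using opp(1)[OF that that] by (simp only: discrim_def)
  show ?thesis
    by (rule exI[of _ rpos], rule exI[of _ rneg])
      (intro conjI allI impI lim_pos lim_neg closest; rule signs discr pos neg roots unique; assumption)
qed

theorem corollary3p1:
  fixes \<Omega> :: "(real ^ 'd) set"
    and DL DM :: "(real ^ 'd \<Rightarrow> real) set"
    and L M :: "(real ^ 'd \<Rightarrow> real) \<Rightarrow> real ^ 'd \<Rightarrow> real"
    and p pm1 pm2 p1 p2 :: "real ^ 'd \<Rightarrow> real"
    and dt qn :: real
  assumes domain: "open \<Omega>" "connected \<Omega>" "\<Omega> \<noteq> {}" "bounded \<Omega>"
    and L: "linear_operator \<Omega> DL L" "self_adjoint_operator \<Omega> DL L" "nonneg_operator \<Omega> DL L"
    and M: "linear_operator \<Omega> DM M" "self_adjoint_operator \<Omega> DM M" "nonneg_operator \<Omega> DM M"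
    and dt: "0 < dt"
    and G: "invertible_operator \<Omega> (G_dom DL L DM) (G_op dt L M)"
    and regular: "ess_bounded \<Omega> p" "ess_bounded \<Omega> pm1" "ess_bounded \<Omega> pm2"
      "p \<in> G_dom DL L DM" "f_half p pm1 \<in> DM"
    and p1: "p1 \<in> G_dom DL L DM"
      "ae_eq \<Omega> (G_op dt L M p1)
         (\<lambda>x. 1 / dt * p x - 1 / 2 * M (L p) x - 1 / 2 * M (\<lambda>y. qn * f_half p pm1 y) x)"
    and p2: "p2 \<in> G_dom DL L DM"
      "ae_eq \<Omega> (G_op dt L M p2) (\<lambda>x. - (1 / 2) * M (f_half p pm1) x)"
    and qn: "0 < qn"
  shows "\<exists>rpos rneg :: real \<Rightarrow> real.
    (\<forall>\<alpha>\<ge>0. \<alpha> > max (- A0_tilde \<Omega> p pm1 p2) (C0_tilde \<Omega> p pm1 pm2 p1 qn / qn\<^sup>2) \<longrightarrow>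
       A1 \<Omega> p pm1 p2 \<alpha> > 0 \<and>
       C1 \<Omega> p pm1 pm2 p1 qn \<alpha> < 0 \<and>
       (B1 \<Omega> p pm1 p1 p2 qn)\<^sup>2 - 4 * A1 \<Omega> p pm1 p2 \<alpha> * C1 \<Omega> p pm1 pm2 p1 qn \<alpha> > 0 \<and>
       rneg \<alpha> < 0 \<and> 0 < rpos \<alpha> \<and>
       {q. A1 \<Omega> p pm1 p2 \<alpha> * q\<^sup>2 + B1 \<Omega> p pm1 p1 p2 qn * q + C1 \<Omega> p pm1 pm2 p1 qn \<alpha> = 0}
         = {rneg \<alpha>, rpos \<alpha>} \<and>
       (\<exists>!q. q > 0 \<and>
          A1 \<Omega> p pm1 p2 \<alpha> * q\<^sup>2 + B1 \<Omega> p pm1 p1 p2 qn * q + C1 \<Omega> p pm1 pm2 p1 qn \<alpha> = 0)) \<and>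
    (rpos \<longlongrightarrow> qn) at_top \<and>
    (rneg \<longlongrightarrow> - qn) at_top \<and>
    (\<forall>\<^sub>F \<alpha> in at_top. \<forall>q.
       is_arg_min (\<lambda>r. \<bar>r - qn\<bar>)
         (\<lambda>r. A1 \<Omega> p pm1 p2 \<alpha> * r\<^sup>2 + B1 \<Omega> p pm1 p1 p2 qn * r + C1 \<Omega> p pm1 pm2 p1 qn \<alpha> = 0) q
       \<longleftrightarrow> q = rpos \<alpha>)"
  \<comment> \<open>Unfolding exposes \<alpha> in the outer coefficients. \<open>B1\<close> does not
    depend on \<alpha> and is matched as a whole with \<open>b\<close>.\<close>
  unfolding A1_def C1_def by (rule relaxed_quadratic_roots[OF qn])

end
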